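(* Fix a nested and regular system of fundamental sequences on an ordinal $\Gamma$ and an infinite set $M\subseteq\mathbb{N}$ with $\min M>1$. For every $\alpha\le\Gamma$, the set $\mathcal{B}^\alpha$ of $\alpha$-size finite subsets of $M$ is an SD-barrier.
   Context: A fundamental sequence for an ordinal $\alpha>0$ is a non-decreasing sequence $(\alpha[n])_{n\in\omega}$ with $\sup_n(\alpha[n]+1)=\alpha$; $0[n]=0$. A system on $\Gamma$ fixes one for each $\alpha\le\Gamma$. It is nested if there are never $\gamma<\beta\le\Gamma$ and $n>1$ with $\gamma>\beta[n]>\gamma[n]$. It is regular if for every $\beta_0+\omega^{\beta_1}\le\Gamma$ with $\beta_0>0$ and the last exponent in the Cantor normal form of $\beta_0$ at least $\beta_1$, $(\beta_0+\omega^{\beta_1})[n]=\beta_0+(\omega^{\beta_1}[n])$ for all $n$. Finite subsets of $\mathbb{N}$ are identified with strictly increasing sequences; for $s=\langle s_0,\dots,s_{m-1}\rangle$, $\alpha[s]=\alpha[s_0]\cdots[s_{m-1}]$ ($\alpha[\langle\rangle]=\alpha$); $s^*=s\setminus\{\max s\}$; $s$ is $\alpha$-size if $\alpha[s]=0$ and, when $s\neq\langle\rangle$, $\alpha[s^*]>0$. Fronts: $\mathcal{B}\subseteq[\mathbb{N}]^{<\omega}$ is a front if $\mathcal{B}=\{\langle\rangle\}$ (degenerate) or (1) $\operatorname{base}(\mathcal{B})=\bigcup\mathcal{B}$ infinite, (2) every infinite $X\subseteq\operatorname{base}(\mathcal{B})$ has $s\in\mathcal{B}$ with $s$ a proper initial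 segment of $X$, (3) no element of $\mathcal{B}$ is a proper initial segment of another. Barrier: front with no $s\subsetneq t$ in it. Smooth: for $s,t\in\mathcal{B}$, $|s|<|t|$, some $i<|s|$ has $s(i)<t(i)$. $T(\mathcal{B})$ is the set of finite subsets of $\operatorname{base}(\mathcal{B})$ having no proper initial segment in $\mathcal{B}$ (a well-founded tree with leaves $\mathcal{B}$); $\operatorname{ht}_{\mathcal{B}}(s)$ is its rank ($0$ on $\mathcal{B}$, else $\sup(\operatorname{ht}_{\mathcal{B}}(s^\frown\langle n\rangle)+1)$); $\operatorname{ht}(\mathcal{B})=\operatorname{ht}_{\mathcal{B}}(\langle\rangle)$. If $\operatorname{base}(\mathcal{B})=\{n\in\operatorname{base}(\mathcal{A}):n\ge m\}$ for some $m$, $\mathcal{A}\oplus\mathcal{B}=\{s^\frown t:s\in\mathcal{B},t\in\mathcal{A},\max s<\min t\}$. A smooth barrier $\mathcal{B}$ with $\operatorname{ht}(\mathcal{B})=\omega^{\beta_0}+\dots+\omega^{\beta_{n-1}}$ in Cantor normal form is decomposable if $\mathcal{B}=\mathcal{B}_0\oplus\dots\oplus\mathcal{B}_{n-1}$ for smooth barriers with $\operatorname{ht}(\mathcal{B}_i)=\omega^{\beta_i}$; an SD-barrier is a smooth decomposable barrier (the degenerate front counts as one). *)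

theory Defs
  imports "HOL-Library.Countable_Set_Type"
begin

section \<open>Countable ordinals\<close>

text \<open>
  The ordinals below \<open>\<omega>\<^sub>1\<close>, realised as the cardinal successor of \<^const>\<open>natLeq\<close> (a well-order in
  which every proper initial segment is countable, and into which every countable well-order embeds
  as a proper initial segment).

  No generality is lost by restricting to countable ordinals.  If every \<open>\<alpha> \<le> \<Gamma>\<close> has a fundamental
  sequence, then \<open>\<Gamma>\<close> is countable: see \<open>countable_of_fundamental_sequences\<close> below, which
  is stated for an element \<open>\<Gamma>\<close> of an arbitrary well-order.  Heights of families of finite sets of
  natural numbers are countable because there are only countably many such sets.
\<close>

typedef cord = "Field (cardSuc natLeq)"
  using Field_cardSuc_not_empty[OF natLeq_Card_order] by blast

instantiation cord :: linorder
begin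

definition less_eq_cord :: "cord \<Rightarrow> cord \<Rightarrow> bool" where
  "a \<le> b \<longleftrightarrow> (Rep_cord a, Rep_cord b) \<in> cardSuc natLeq"

definition less_cord :: "cord \<Rightarrow> cord \<Rightarrow> bool" where
  "a < b \<longleftrightarrow> a \<le> b \<and> \<not> b \<le> (a::cord)"

lemma cardSuc_natLeq_Well_order: "Well_order (cardSuc natLeq)"
  by (rule cardSuc_Well_order[OF natLeq_Card_order])

instance
proof
  have lin: "Linear_order (cardSuc natLeq)"
    using cardSuc_natLeq_Well_order by (simp add: well_order_on_def)
  then have refl: "refl_on (Field (cardSuc natLeq)) (cardSuc natLeq)"
    and tr: "trans (cardSuc natLeq)" and an: "antisym (cardSuc natLeq)"
    and tot: "total_on (Field (cardSuc natLeq)) (cardSuc natLeq)"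
    by (simp_all add: order_on_defs)
  fix a b c :: cord
  show "a < b \<longleftrightarrow> a \<le> b \<and> \<not> b \<le> a" by (rule less_cord_def)
  show r: "a \<le> a"
    unfolding less_eq_cord_def using refl Rep_cord by (rule refl_onD)
  show "a \<le> b \<Longrightarrow> b \<le> c \<Longrightarrow> a \<le> c"
    unfolding less_eq_cord_def using tr by (rule transD)
  show "a \<le> b \<Longrightarrow> b \<le> a \<Longrightarrow> a = b"
    unfolding less_eq_cord_def using an Rep_cord_inject by (meson antisymD)
  show "a \<le> b \<or> b \<le> a"
  proof (cases "a = b")
    case False
    then have "Rep_cord a \<noteq> Rep_cord b" by (simp add: Rep_cord_inject)
    then show ?thesis
      unfolding less_eq_cord_def using tot Rep_cord[of a] Rep_cord[of b]
      by (auto simp: total_on_def)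
  qed (use r in simp)
qed

end

instance cord :: wellorder
proof (rule wf_wellorderI)
  have wf: "wf (cardSuc natLeq - Id)"
    using cardSuc_natLeq_Well_order by (simp add: well_order_on_def)
  have "{(x, y::cord). x < y} \<subseteq> inv_image (cardSuc natLeq - Id) Rep_cord"
    by (auto simp: less_cord_def less_eq_cord_def Rep_cord_inject)
  then show "wf {(x, y::cord). x < y}"
    using wf_inv_image[OF wf] wf_subset by blast
qed intro_classes

instantiation cord :: conditionally_complete_linorder
begin

definition "Sup (X :: cord set) = (LEAST y. \<forall>x\<in>X. x \<le> y)"
definition "Inf (X :: cord set) = (LEAST x. x \<in> X)"
definition "sup (x :: cord) y = max x y"
definition "inf (x :: cord) y = min x y"

instance
proof
  fix x y z :: cord and X :: "cord set"
  show "inf x y \<le> x" "inf x y \<le> y" "x \<le> sup x y" "y \<le> sup x y"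
    by (simp_all add: inf_cord_def sup_cord_def)
  show "x \<le> y \<Longrightarrow> x \<le> z \<Longrightarrow> x \<le> inf y z" by (simp add: inf_cord_def)
  show "y \<le> x \<Longrightarrow> z \<le> x \<Longrightarrow> sup y z \<le> x" by (simp add: sup_cord_def)
  show "Inf X \<le> x" if "x \<in> X" "bdd_below X"
    unfolding Inf_cord_def using that(1) by (rule Least_le)
  show "z \<le> Inf X" if "X \<noteq> {}" "\<And>x. x \<in> X \<Longrightarrow> z \<le> x"
    unfolding Inf_cord_def using that by (metis LeastI ex_in_conv)
  show "Sup X \<le> z" if "X \<noteq> {}" "\<And>x. x \<in> X \<Longrightarrow> x \<le> z"
    unfolding Sup_cord_def using that(2) by (intro Least_le) blast
  show "x \<le> Sup X" if x: "x \<in> X" and X: "bdd_above X"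
  proof -
    obtain y where "\<forall>x\<in>X. x \<le> y" using X by (auto simp: bdd_above_def)
    then have "\<forall>x\<in>X. x \<le> Sup X" unfolding Sup_cord_def by (rule LeastI)
    then show ?thesis using x by blast
  qed
qed

end

context
  includes cardinal_syntax
begin

lemma countable_lessThan_cord: "countable {..<a::cord}"
proof -
  have "|underS (cardSuc natLeq) (Rep_cord a)| <o cardSuc natLeq"
    using card_of_underS[OF cardSuc_Card_order[OF natLeq_Card_order] Rep_cord] .
  then have "|underS (cardSuc natLeq) (Rep_cord a)| \<le>o natLeq"
    using cardSuc_ordLeq_ordLess[OF natLeq_Card_order card_of_Card_order] by blast
  then have "countable (underS (cardSuc natLeq) (Rep_cord a))"
    by (simp add: countable_card_le_natLeq)
  moreover have "Rep_cord ` {..<a} \<subseteq> underS (cardSuc natLeq) (Rep_cord a)"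
    by (auto simp: underS_def less_cord_def less_eq_cord_def Rep_cord_inject)
  ultimately have "countable (Rep_cord ` {..<a})" by (rule countable_subset[rotated])
  then show ?thesis
    by (rule countable_image_inj_on) (simp add: inj_on_def Rep_cord_inject)
qed

text \<open>All suprema of countable sets are therefore genuine least upper bounds.\<close>

lemma strictly_bounded_cord:
  fixes A :: "cord set"
  assumes "countable A"
  shows "\<exists>b. \<forall>a\<in>A. a < b"
proof (rule ccontr)
  let ?r = "cardSuc natLeq"
  assume "\<nexists>b. \<forall>a\<in>A. a < b"
  then have unb: "\<And>b. \<exists>a\<in>A. b \<le> a" by (meson not_le)
  have "{..a} = insert a {..<a}" for a :: cord by auto
  then have "countable {..a}" for a :: cord
    using countable_lessThan_cord by (metis countable_insert)
  then have "countable (\<Union>a\<in>A. {..a})" using assms by blast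
  moreover have "(\<Union>a\<in>A. {..a}) = UNIV" using unb by auto
  ultimately have "countable (Rep_cord ` (UNIV::cord set))" by simp
  then have "countable (Field ?r)"
    using type_definition.Rep_range[OF type_definition_cord] by simp
  then have "|Field ?r| \<le>o |UNIV::nat set|" by (simp add: countable_card_of_nat)
  then have "?r \<le>o natLeq"
    using card_of_Field_ordIso[OF cardSuc_Card_order[OF natLeq_Card_order]] card_of_nat
    by (meson ordIso_ordLeq_trans ordIso_symmetric ordLeq_ordIso_trans)
  then show False
    using cardSuc_greater[OF natLeq_Card_order] not_ordLess_ordLeq by blast
qed

end

lemma bdd_above_cord: "countable (A :: cord set) \<Longrightarrow> bdd_above A"
  using strictly_bounded_cord by (meson bdd_above.I less_imp_le)

lemma countable_of_fundamental_sequences: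
  fixes \<Gamma> :: "'a::wellorder"
  assumes "\<And>\<alpha> \<beta>. \<beta> < \<alpha> \<Longrightarrow> \<alpha> \<le> \<Gamma> \<Longrightarrow> \<exists>f::nat \<Rightarrow> 'a. \<forall>\<gamma>. \<gamma> < \<alpha> \<longleftrightarrow> (\<exists>n. \<gamma> \<le> f n)"
  shows "countable {..\<Gamma>}"
proof -
  have "countable {..\<alpha>}" if "\<alpha> \<le> \<Gamma>" for \<alpha>
    using that
  proof (induction \<alpha> rule: less_induct)
    case (less \<alpha>)
    have "countable {..<\<alpha>}"
    proof (cases "\<exists>\<beta>. \<beta> < \<alpha>")
      case True
      then obtain f :: "nat \<Rightarrow> 'a" where f: "\<And>\<gamma>. \<gamma> < \<alpha> \<longleftrightarrow> (\<exists>n. \<gamma> \<le> f n)"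
        using assms less.prems by blast
      then have lt: "f n < \<alpha>" for n by blast
      then have "countable {..f n}" for n
        using less.IH less.prems by (meson less_imp_le order_trans)
      then have "countable (\<Union>n. {..f n})" by blast
      moreover have "{..<\<alpha>} = (\<Union>n. {..f n})" using f by auto
      ultimately show ?thesis by simp
    next
      case False
      then have "{..<\<alpha>} = {}" by auto
      then show ?thesis by simp
    qed
    moreover have "{..\<alpha>} = insert \<alpha> {..<\<alpha>}" by auto
    ultimately show ?case by simp
  qed
  then show ?thesis by blast
qed

section \<open>Ordinal arithmetic\<close>

definition osuc :: "cord \<Rightarrow> cord" where "osuc a = (LEAST b. a < b)"

instantiation cord :: "{zero, one, plus, times}"
begin

definition "0 = (LEAST a :: cord. True)"
definition "1 = osuc (0 :: cord)"

function plus_cord :: "cord \<Rightarrow> cord \<Rightarrow> cord" where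
  "plus_cord a b = max a (SUP d\<in>{..<b}. osuc (plus_cord a d))"
  by pat_completeness auto
termination
  by (relation "inv_image {(x, y). x < y} snd") (simp_all only: wf_inv_image wf, simp)

declare plus_cord.simps [simp del]

function times_cord :: "cord \<Rightarrow> cord \<Rightarrow> cord" where
  "times_cord a b = (SUP d\<in>{..<b}. times_cord a d + a)"
  by pat_completeness auto
termination
  by (relation "inv_image {(x, y). x < y} snd") (simp_all only: wf_inv_image wf, simp)

declare times_cord.simps [simp del]

instance ..

end

definition omega :: cord  ("\<omega>") where "\<omega> = (SUP n. (osuc ^^ n) 0)"

text \<open>\<open>omega_pow b\<close> is \<open>\<omega>\<^sup>b\<close>.\<close>

function omega_pow :: "cord \<Rightarrow> cord" where
  "omega_pow b = max 1 (SUP d\<in>{..<b}. omega_pow d * \<omega>)"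
  by pat_completeness auto
termination
  by (relation "{(x, y). x < y}") (simp_all only: wf, simp)

declare omega_pow.simps [simp del]

definition omega_sum :: "cord list \<Rightarrow> cord" where
  "omega_sum bs = foldr (\<lambda>b a. omega_pow b + a) bs 0"

text \<open>\<open>bs\<close> lists the exponents of the Cantor normal form of \<open>a\<close>, with repetitions.\<close>

definition is_CNF :: "cord \<Rightarrow> cord list \<Rightarrow> bool" where
  "is_CNF a bs \<longleftrightarrow> sorted_wrt (\<ge>) bs \<and> a = omega_sum bs"

section \<open>Fundamental sequences\<close>

definition fundamental_sequence :: "cord \<Rightarrow> (nat \<Rightarrow> cord) \<Rightarrow> bool" where
  "fundamental_sequence \<alpha> f \<longleftrightarrow>
     (if \<alpha> = 0 then \<forall>n. f n = 0 else mono f \<and> (SUP n. osuc (f n)) = \<alpha>)"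

text \<open>In a system \<open>F\<close> on \<open>\<Gamma>\<close>, \<open>F \<alpha> n\<close> is \<open>\<alpha>[n]\<close>; the values \<open>F \<alpha>\<close> for \<open>\<alpha> > \<Gamma>\<close> are irrelevant.\<close>

definition fs_system :: "cord \<Rightarrow> (cord \<Rightarrow> nat \<Rightarrow> cord) \<Rightarrow> bool" where
  "fs_system \<Gamma> F \<longleftrightarrow> (\<forall>\<alpha>\<le>\<Gamma>. fundamental_sequence \<alpha> (F \<alpha>))"

definition nested_system :: "cord \<Rightarrow> (cord \<Rightarrow> nat \<Rightarrow> cord) \<Rightarrow> bool" where
  "nested_system \<Gamma> F \<longleftrightarrow>
     \<not> (\<exists>\<gamma> \<beta> n. \<gamma> < \<beta> \<and> \<beta> \<le> \<Gamma> \<and> n > 1 \<and> \<gamma> > F \<beta> n \<and> F \<beta> n > F \<gamma> n)"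

definition regular_system :: "cord \<Rightarrow> (cord \<Rightarrow> nat \<Rightarrow> cord) \<Rightarrow> bool" where
  "regular_system \<Gamma> F \<longleftrightarrow>
     (\<forall>\<beta>0 \<beta>1 bs. \<beta>0 > 0 \<and> is_CNF \<beta>0 bs \<and> last bs \<ge> \<beta>1 \<and> \<beta>0 + omega_pow \<beta>1 \<le> \<Gamma> \<longrightarrow>
        (\<forall>n. F (\<beta>0 + omega_pow \<beta>1) n = \<beta>0 + F (omega_pow \<beta>1) n))"

definition fs_apply :: "(cord \<Rightarrow> nat \<Rightarrow> cord) \<Rightarrow> cord \<Rightarrow> nat set \<Rightarrow> cord" where
  "fs_apply F \<alpha> s = foldl F \<alpha> (sorted_list_of_set s)"

definition alpha_size :: "(cord \<Rightarrow> nat \<Rightarrow> cord) \<Rightarrow> cord \<Rightarrow> nat set \<Rightarrow> bool" where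
  "alpha_size F \<alpha> s \<longleftrightarrow>
     finite s \<and> fs_apply F \<alpha> s = 0 \<and> (s \<noteq> {} \<longrightarrow> fs_apply F \<alpha> (s - {Max s}) > 0)"

definition size_family :: "(cord \<Rightarrow> nat \<Rightarrow> cord) \<Rightarrow> nat set \<Rightarrow> cord \<Rightarrow> nat set set" where
  "size_family F M \<alpha> = {s. s \<subseteq> M \<and> alpha_size F \<alpha> s}"

section \<open>Fronts and barriers\<close>

definition proper_init_seg :: "nat set \<Rightarrow> nat set \<Rightarrow> bool" where
  "proper_init_seg s X \<longleftrightarrow> s \<subset> X \<and> (\<forall>y\<in>s. \<forall>x\<in>X. x < y \<longrightarrow> x \<in> s)"

abbreviation base :: "nat set set \<Rightarrow> nat set" where
  "base B \<equiv> \<Union>B"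

definition front :: "nat set set \<Rightarrow> bool" where
  "front B \<longleftrightarrow> (\<forall>s\<in>B. finite s) \<and>
     (B = {{}} \<or>
      (infinite (base B) \<and>
       (\<forall>X. infinite X \<and> X \<subseteq> base B \<longrightarrow> (\<exists>s\<in>B. proper_init_seg s X)) \<and>
       (\<forall>s\<in>B. \<forall>t\<in>B. \<not> proper_init_seg s t)))"

definition barrier :: "nat set set \<Rightarrow> bool" where
  "barrier B \<longleftrightarrow> front B \<and> (\<forall>s\<in>B. \<forall>t\<in>B. \<not> s \<subset> t)"

definition smooth :: "nat set set \<Rightarrow> bool" where
  "smooth B \<longleftrightarrow> (\<forall>s\<in>B. \<forall>t\<in>B. card s < card t \<longrightarrow>
     (\<exists>i<card s. sorted_list_of_set s ! i < sorted_list_of_set t ! i))"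

definition front_tree :: "nat set set \<Rightarrow> nat set set" where
  "front_tree B = {s. finite s \<and> s \<subseteq> base B \<and> \<not> (\<exists>t\<in>B. proper_init_seg t s)}"

text \<open>\<open>(t, s) \<in> tree_child B\<close>: \<open>t\<close> is an immediate successor of \<open>s\<close> in the tree of \<open>B\<close>.\<close>

definition tree_child :: "nat set set \<Rightarrow> (nat set \<times> nat set) set" where
  "tree_child B = {(t, s). s \<in> front_tree B \<and> t \<in> front_tree B \<and>
     (\<exists>n. (\<forall>m\<in>s. m < n) \<and> t = insert n s)}"

text \<open>
  For a front \<open>B\<close> the relation \<open>tree_child B\<close> is well-founded, so the recursion equation holds;
  the value is not meaningful for other families.
\<close>

definition node_height :: "nat set set \<Rightarrow> nat set \<Rightarrow> cord" where
  "node_height B = wfrec (tree_child B)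
     (\<lambda>h s. if s \<in> B then 0 else (SUP t\<in>{t. (t, s) \<in> tree_child B}. osuc (h t)))"

definition height :: "nat set set \<Rightarrow> cord" where
  "height B = node_height B {}"

section \<open>Decomposable barriers\<close>

definition oplus_defined :: "nat set set \<Rightarrow> nat set set \<Rightarrow> bool" where
  "oplus_defined A B \<longleftrightarrow> (\<exists>m. base B = {n \<in> base A. n \<ge> m})"

definition front_oplus :: "nat set set \<Rightarrow> nat set set \<Rightarrow> nat set set" where
  "front_oplus A B = {s \<union> t |s t. s \<in> B \<and> t \<in> A \<and> (\<forall>x\<in>s. \<forall>y\<in>t. x < y)}"

text \<open>
  \<open>is_oplus Bs B\<close>: \<open>B\<close> is the sum of the nonempty list \<open>Bs\<close>, bracketed to the left, and
  every binary sum involved satisfies the condition on the bases.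
\<close>

inductive is_oplus :: "nat set set list \<Rightarrow> nat set set \<Rightarrow> bool" where
  single: "is_oplus [B] B"
| snoc: "is_oplus Bs A \<Longrightarrow> oplus_defined A B \<Longrightarrow> is_oplus (Bs @ [B]) (front_oplus A B)"

definition decomposable :: "nat set set \<Rightarrow> bool" where
  "decomposable B \<longleftrightarrow>
     (\<exists>bs Bs. is_CNF (height B) bs \<and> length Bs = length bs \<and> is_oplus Bs B \<and>
        (\<forall>i<length bs. barrier (Bs ! i) \<and> smooth (Bs ! i) \<and> height (Bs ! i) = omega_pow (bs ! i)))"

definition SD_barrier :: "nat set set \<Rightarrow> bool" where
  "SD_barrier B \<longleftrightarrow> B = {{}} \<or> (barrier B \<and> smooth B \<and> decomposable B)"

end

theory Submission
  imports Defs
begin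

text \<open>
  Write \<open>a \<rightarrow>\<^sub>n b\<close> if \<open>b\<close> arises from \<open>a\<close> by iterating \<open>\<cdot>[n]\<close>.  Nestedness says that the descent from
  \<open>a[m]\<close> along \<open>\<cdot>[n]\<close> cannot jump over \<open>a[n]\<close>, so \<open>a[m] \<rightarrow>\<^sub>n a[n]\<close> whenever \<open>1 < n \<le> m\<close>; consequently
  \<open>\<rightarrow>\<^sub>n\<close> grows with \<open>n\<close>, and \<open>\<alpha>[t] \<le> \<alpha>[s]\<close> whenever \<open>|s| = |t|\<close> and \<open>t\<close> is pointwise below \<open>s\<close>.
  This yields smoothness, and smoothness excludes proper inclusions.  By definition of fundamental
  sequences, a node \<open>s\<close> of the tree has height \<open>\<alpha>[s]\<close>.  Regularity propagates from powers of \<open>\<omega>\<close> to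
  \<open>(\<beta> + \<delta>)[n] = \<beta> + \<delta>[n]\<close> for \<open>0 < \<delta> \<le> \<omega>\<^sup>e\<close> with \<open>e\<close> the last exponent of \<open>\<beta>\<close>; since \<open>\<delta>[n] < \<delta>\<close>, this
  can be iterated and splits off the last summand of the Cantor normal form.
\<close>

section \<open>Countable ordinals\<close>

lemma zero_le_cord [simp]: "0 \<le> (a :: cord)"
  unfolding zero_cord_def by (rule Least_le) simp

lemma not_less_zero_cord [simp]: "\<not> a < (0 :: cord)"
  by (simp add: not_less)

lemma zero_less_cord_iff: "0 < (a :: cord) \<longleftrightarrow> a \<noteq> 0"
  by (metis neq_iff not_less_zero_cord)

text \<open>For the empty set \<open>Sup\<close> yields the least ordinal, so the equivalence also
  covers suprema over \<open>{..<0}\<close>.\<close>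

lemma Sup_cord_le_iff:
  assumes "countable (A :: cord set)"
  shows "Sup A \<le> c \<longleftrightarrow> (\<forall>a\<in>A. a \<le> c)"
proof (cases "A = {}")
  case True
  then show ?thesis by (simp add: Sup_cord_def Least_le)
next
  case False
  then show ?thesis using assms by (intro cSup_le_iff bdd_above_cord)
qed

lemma SUP_lessThan_cord_le_iff: "(SUP d\<in>{..<b}. f d) \<le> (c :: cord) \<longleftrightarrow> (\<forall>d<b::cord. f d \<le> c)"
  by (subst Sup_cord_le_iff) (auto simp: countable_lessThan_cord)

lemma less_osuc: "a < osuc a"
proof -
  have "\<exists>b. a < b" using strictly_bounded_cord[of "{a}"] by simp
  then show ?thesis unfolding osuc_def by (rule LeastI_ex)
qed

lemma osuc_le_iff: "osuc a \<le> b \<longleftrightarrow> a < b"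
  using less_osuc[of a] unfolding osuc_def by (meson Least_le less_le_trans)

lemma one_le_cord_iff: "(1 :: cord) \<le> a \<longleftrightarrow> 0 < a"
  by (simp add: one_cord_def osuc_le_iff)

text \<open>Sums and heights are suprema, known through their upper bounds; comparing these avoids a
  case distinction into successors and limits.\<close>

lemma cord_eq_leI: "(\<And>c. a \<le> c \<longleftrightarrow> b \<le> c) \<Longrightarrow> a = (b :: cord)"
  by (meson order_antisym order_refl)

section \<open>Ordinal addition\<close>

lemma plus_cord_le_iff: "a + b \<le> (c :: cord) \<longleftrightarrow> a \<le> c \<and> (\<forall>d<b. a + d < c)"
  by (subst plus_cord.simps) (simp add: SUP_lessThan_cord_le_iff osuc_le_iff)

lemma less_plus_cord_iff: "c < a + (b :: cord) \<longleftrightarrow> c < a \<or> (\<exists>d<b. c \<le> a + d)"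
  by (metis not_less plus_cord_le_iff)

lemma times_cord_le_iff: "a * b \<le> (c :: cord) \<longleftrightarrow> (\<forall>d<b. a * d + a \<le> c)"
  by (subst times_cord.simps) (simp add: SUP_lessThan_cord_le_iff)

lemma omega_pow_le_iff: "omega_pow b \<le> c \<longleftrightarrow> 0 < c \<and> (\<forall>d<b. omega_pow d * \<omega> \<le> c)"
  by (subst omega_pow.simps) (simp add: SUP_lessThan_cord_le_iff one_le_cord_iff)

lemma omega_le_iff: "\<omega> \<le> c \<longleftrightarrow> (\<forall>n. (osuc ^^ n) 0 \<le> c)"
  unfolding omega_def by (subst Sup_cord_le_iff) auto

lemma plus_cord_zero [simp]: "a + (0 :: cord) = a"
  by (rule cord_eq_leI) (simp add: plus_cord_le_iff)

lemma plus_cord_strict_mono: "b < c \<Longrightarrow> a + b < a + (c :: cord)"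
  using plus_cord_le_iff[of a c "a + c"] by simp

lemma plus_cord_mono: "b \<le> c \<Longrightarrow> a + b \<le> a + (c :: cord)"
  by (metis le_less plus_cord_strict_mono)

lemma le_plus_cord_left: "a \<le> a + (b :: cord)"
  using plus_cord_le_iff[of a b "a + b"] by simp

text \<open>A strictly increasing map on a well-order never drops below the identity: at a least
  \<open>b\<close> with \<open>a + b < b\<close>, the value \<open>a + b\<close> would be a smaller
  such point.\<close>

lemma le_plus_cord_right: "b \<le> a + (b :: cord)"
proof (induction b rule: less_induct)
  case (less b)
  show ?case
  proof (rule ccontr)
    assume "\<not> b \<le> a + b"
    then have "a + b < b" by simp
    with less[OF this] plus_cord_strict_mono[OF this, of a] show False by simp
  qed
qed

lemma zero_plus_cord [simp]: "0 + (b :: cord) = b"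
proof (induction b rule: less_induct)
  case (less b)
  then have "0 + b \<le> b" by (simp add: plus_cord_le_iff)
  then show ?case using le_plus_cord_right[of b 0] by simp
qed

lemma plus_cord_assoc: "(a + b) + c = a + (b + (c :: cord))"
proof (induction c rule: less_induct)
  case (less c)
  show ?case
  proof (rule cord_eq_leI)
    fix x
    have "(a + b) + c \<le> x \<longleftrightarrow> a + b \<le> x \<and> (\<forall>d<c. a + (b + d) < x)"
      using less by (simp add: plus_cord_le_iff[of "a + b" c])
    \<comment> \<open>The ordinals below \<open>b + c\<close> are those below \<open>b\<close> and
      those at most some \<open>b + d\<close> with \<open>d < c\<close>; the two conditions treat
      these two kinds.\<close>
    also have "\<dots> \<longleftrightarrow> a + (b + c) \<le> x"
      unfolding plus_cord_le_iff[of a] less_plus_cord_iff[of _ b c]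
      by (meson le_less_trans order_refl plus_cord_mono)
    finally show "(a + b) + c \<le> x \<longleftrightarrow> a + (b + c) \<le> x" .
  qed
qed

text \<open>The least \<open>d\<close> with \<open>b \<le> a + d\<close> works: minimality puts
  \<open>a + e\<close> below \<open>b\<close> for every \<open>e < d\<close>.\<close>

lemma plus_cord_difference:
  assumes "a \<le> (b :: cord)"
  shows "\<exists>d. b = a + d"
proof -
  define d where "d = (LEAST d. b \<le> a + d)"
  have le: "b \<le> a + d" unfolding d_def by (rule LeastI, rule le_plus_cord_right)
  have "a + e < b" if "e < d" for e
    using not_less_Least[OF that[unfolded d_def]] by simp
  then have "a + d \<le> b" using assms by (simp add: plus_cord_le_iff)
  with le have "b = a + d" by simp
  then show ?thesis ..
qed

lemma plus_cord_pos_left: "0 < a \<Longrightarrow> 0 < a + (b :: cord)"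
  using le_plus_cord_left less_le_trans by blast

section \<open>Multiplication, \<omega> and its powers\<close>

lemma times_cord_zero: "a * (0 :: cord) = 0"
  by (rule cord_eq_leI) (simp add: times_cord_le_iff)

lemma times_cord_osuc: "a * osuc b = a * b + (a :: cord)"
proof (rule order_antisym)
  show "a * b + a \<le> a * osuc b"
    using times_cord_le_iff[of a "osuc b" "a * osuc b"] less_osuc by simp
  have "a * d + a \<le> a * b + a" if "d < osuc b" for d
  proof (cases "d = b")
    case False
    then have "d < b" using that by (metis osuc_le_iff not_less neq_iff)
    then have "a * d + a \<le> a * b"
      using times_cord_le_iff[of a b "a * b"] by simp
    then show ?thesis using le_plus_cord_left order_trans by blast
  qed simp
  then show "a * osuc b \<le> a * b + a" by (simp add: times_cord_le_iff[of a "osuc b"])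
qed

lemma less_omega_iff: "a < \<omega> \<longleftrightarrow> (\<exists>n. a = (osuc ^^ n) 0)"
proof
  assume "\<exists>n. a = (osuc ^^ n) 0"
  then obtain n where n: "a = (osuc ^^ n) 0" ..
  have "a < (osuc ^^ Suc n) 0" by (simp add: n less_osuc)
  then show "a < \<omega>" using omega_le_iff[of \<omega>] by (meson less_le_trans order_refl)
next
  have "\<exists>m. a = (osuc ^^ m) 0" if "a < (osuc ^^ n) 0" for n
    using that
  proof (induction n)
    case (Suc n)
    then have "a \<le> (osuc ^^ n) 0" by (metis funpow.simps(2) comp_apply osuc_le_iff not_less)
    then show ?case using Suc.IH by (auto simp: le_less)
  qed simp
  moreover assume "a < \<omega>"
  then have "\<exists>n. a < (osuc ^^ n) 0" by (metis omega_le_iff not_less)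
  ultimately show "\<exists>n. a = (osuc ^^ n) 0" by blast
qed

text \<open>Absorbing \<open>a\<close> once means absorbing every finite multiple of
  \<open>a\<close>. Used in contraposition: a \<open>c\<close> below \<open>a * \<omega>\<close>
  satisfies \<open>a + c \<noteq> c\<close>.\<close>

lemma times_omega_le_of_absorb:
  assumes "a + c = (c :: cord)"
  shows "a * \<omega> \<le> c"
proof -
  have "a * ((osuc ^^ n) 0) + c = c" for n
    by (induction n) (simp_all add: times_cord_zero times_cord_osuc plus_cord_assoc assms)
  moreover have "a \<le> c" using assms le_plus_cord_left by metis
  ultimately have "a * d + a \<le> c" if "d < \<omega>" for d
    using that plus_cord_mono less_omega_iff by metis
  then show ?thesis by (simp add: times_cord_le_iff)
qed

lemma less_times_omega:
  assumes "0 < a"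
  shows "a < a * \<omega>"
proof -
  have "osuc 0 = (osuc ^^ 1) 0" by simp
  then have "osuc 0 < \<omega>" using less_omega_iff by blast
  then have "a * osuc 0 + a \<le> a * \<omega>" using times_cord_le_iff[of a \<omega> "a * \<omega>"] by simp
  then show ?thesis
    using plus_cord_strict_mono[OF assms, of a] by (simp add: times_cord_osuc times_cord_zero)
qed

lemma omega_pow_pos: "0 < omega_pow b"
  using omega_pow_le_iff[of b "omega_pow b"] by simp

lemma omega_pow_times_omega_le: "d < b \<Longrightarrow> omega_pow d * \<omega> \<le> omega_pow b"
  using omega_pow_le_iff[of b "omega_pow b"] by simp

lemma omega_pow_strict_mono: "a < b \<Longrightarrow> omega_pow a < omega_pow b"
  using less_times_omega[OF omega_pow_pos] omega_pow_times_omega_le less_le_trans by blast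

lemma omega_pow_le_mono_iff: "omega_pow a \<le> omega_pow b \<longleftrightarrow> a \<le> b"
  by (metis le_less not_less omega_pow_strict_mono)

lemma le_omega_pow: "b \<le> omega_pow b"
proof (induction b rule: less_induct)
  case (less b)
  show ?case
  proof (rule ccontr)
    assume "\<not> b \<le> omega_pow b"
    then have "omega_pow b < b" by simp
    with less[OF this] omega_pow_strict_mono[OF this] show False by simp
  qed
qed

section \<open>Cantor normal forms\<close>

lemma omega_sum_Nil [simp]: "omega_sum [] = 0"
  by (simp add: omega_sum_def)

lemma omega_sum_Cons [simp]: "omega_sum (b # bs) = omega_pow b + omega_sum bs"
  by (simp add: omega_sum_def)

lemma omega_sum_append: "omega_sum (as @ bs) = omega_sum as + omega_sum bs"
  by (induction as) (simp_all add: plus_cord_assoc)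

lemma omega_sum_pos_iff: "0 < omega_sum bs \<longleftrightarrow> bs \<noteq> []"
  by (cases bs) (simp_all add: plus_cord_pos_left omega_pow_pos)

lemma omega_pow_le_omega_sum: "b \<in> set bs \<Longrightarrow> omega_pow b \<le> omega_sum bs"
  by (induction bs) (auto simp: le_plus_cord_left intro: order_trans le_plus_cord_right)

text \<open>At the least \<open>b\<close> with \<open>a < omega_pow b\<close>, the recursion for
  \<open>omega_pow\<close> supplies \<open>d < b\<close> with
  \<open>a < omega_pow d * \<omega>\<close>, and minimality gives the lower bound.\<close>

lemma leading_omega_pow:
  assumes "0 < a"
  shows "\<exists>d. omega_pow d \<le> a \<and> a < omega_pow d * \<omega>"
proof -
  define b where "b = (LEAST b. a < omega_pow b)"
  have "a < omega_pow (osuc a)" using le_omega_pow less_osuc less_le_trans by blast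
  then have "a < omega_pow b" unfolding b_def by (rule LeastI)
  then obtain d where d: "d < b" "a < omega_pow d * \<omega>"
    using assms by (metis omega_pow_le_iff not_less)
  then have "omega_pow d \<le> a" using not_less_Least[of d "\<lambda>b. a < omega_pow b"] unfolding b_def by auto
  then show ?thesis using d by blast
qed

lemma CNF_exists: "\<exists>bs. is_CNF a bs"
proof (induction a rule: less_induct)
  case (less a)
  show ?case
  proof (cases "a = 0")
    case True
    then have "is_CNF a []" by (simp add: is_CNF_def)
    then show ?thesis ..
  next
    case False
    then obtain d where d: "omega_pow d \<le> a" "a < omega_pow d * \<omega>"
      using leading_omega_pow zero_less_cord_iff by blast
    then obtain r where r: "a = omega_pow d + r" using plus_cord_difference by blast
    \<comment> \<open>If \<open>r = a\<close>, then \<open>a\<close> absorbs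
      \<open>omega_pow d\<close>, which forces
      \<open>omega_pow d * \<omega> \<le> a\<close>.\<close>
    have "r \<noteq> a" using r d(2) times_omega_le_of_absorb by (metis not_less)
    then have ra: "r < a" using r le_plus_cord_right by (metis le_less)
    then obtain bs where bs: "is_CNF r bs" using less by blast
    \<comment> \<open>A larger exponent would make the remainder at least
      \<open>omega_pow d * \<omega>\<close>, hence exceed \<open>a\<close>.\<close>
    have "b \<le> d" if "b \<in> set bs" for b
    proof (rule ccontr)
      assume "\<not> b \<le> d"
      then have "omega_pow d * \<omega> \<le> omega_pow b" by (simp add: omega_pow_times_omega_le)
      also have "\<dots> \<le> r" using bs that omega_pow_le_omega_sum by (auto simp: is_CNF_def)
      finally show False using ra d(2) by simp
    qed
    then have "is_CNF a (d # bs)" using bs r by (simp add: is_CNF_def)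
    then show ?thesis ..
  qed
qed

section \<open>Increasing sequences\<close>

lemma sorted_list_of_set_union:
  assumes "finite s" "finite t" "\<And>x y. x \<in> s \<Longrightarrow> y \<in> t \<Longrightarrow> x < y"
  shows "sorted_list_of_set (s \<union> t) = sorted_list_of_set s @ sorted_list_of_set (t :: 'a::linorder set)"
proof (rule sorted_distinct_set_unique)
  show "distinct (sorted_list_of_set s @ sorted_list_of_set t)"
    using assms by (auto dest: less_imp_neq)
  show "sorted (sorted_list_of_set s @ sorted_list_of_set t)"
    using assms by (auto simp: sorted_append less_imp_le)
qed (use assms in auto)

lemma fs_apply_empty [simp]: "fs_apply F a {} = a"
  by (simp add: fs_apply_def)

lemma fs_apply_union:
  assumes "finite s" "finite t" "\<And>x y. x \<in> s \<Longrightarrow> y \<in> t \<Longrightarrow> x < y"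
  shows "fs_apply F a (s \<union> t) = fs_apply F (fs_apply F a s) t"
  using assms by (simp add: fs_apply_def sorted_list_of_set_union)

lemma fs_apply_insert:
  assumes "finite s" "\<And>x. x \<in> s \<Longrightarrow> x < n"
  shows "fs_apply F a (insert n s) = F (fs_apply F a s) n"
  using fs_apply_union[of s "{n}" F a] assms by (simp add: fs_apply_def)

lemma alpha_size_insert:
  assumes "finite s" "\<And>x. x \<in> s \<Longrightarrow> x < n"
  shows "alpha_size F a (insert n s) \<longleftrightarrow> F (fs_apply F a s) n = 0 \<and> 0 < fs_apply F a s"
proof -
  have "Max (insert n s) = n" using assms by (intro Max_eqI) (auto simp: less_imp_le)
  moreover have "n \<notin> s" using assms by blast
  ultimately show ?thesis using assms by (simp add: alpha_size_def fs_apply_insert)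
qed

lemma finite_eq_insert_Max:
  assumes "finite (s :: 'a::linorder set)" "s \<noteq> {}"
  obtains n A where "s = insert n A" "finite A" "\<And>x. x \<in> A \<Longrightarrow> x < n"
proof
  show "s = insert (Max s) (s - {Max s})" using assms by (simp add: insert_absorb)
  show "x < Max s" if "x \<in> s - {Max s}" for x
    using that assms by (auto simp: less_le)
qed (use assms in simp)

lemma proper_init_seg_insert:
  assumes n: "\<And>x. x \<in> s \<Longrightarrow> x < n" and u: "u = s \<or> proper_init_seg u s"
  shows "proper_init_seg u (insert n s)"
proof -
  have init: "x \<in> u" if "x \<in> s" "y \<in> u" "x < y" for x y
    using u that by (auto simp: proper_init_seg_def)
  have us: "u \<subseteq> s" using u by (auto simp: proper_init_seg_def)
  show ?thesis
    unfolding proper_init_seg_def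
  proof (intro conjI ballI impI)
    have "n \<notin> s" using n by blast
    then show "u \<subset> insert n s" using us by blast
    fix y x assume "y \<in> u" "x \<in> insert n s" "x < y"
    then show "x \<in> u" using init us n by (metis insertE less_asym subsetD)
  qed
qed

text \<open>Pigeonhole: otherwise the first \<open>i + 1\<close> elements of \<open>s\<close> would
  all be among the first \<open>i\<close> elements of \<open>t\<close>.\<close>

lemma nth_sorted_list_of_subset_ge:
  assumes "finite t" "s \<subseteq> t" "i < card s"
  shows "sorted_list_of_set t ! i \<le> (sorted_list_of_set s ! i :: 'a::linorder)"
proof (rule ccontr)
  let ?xs = "sorted_list_of_set s" and ?ys = "sorted_list_of_set t"
  have fs: "finite s" using assms finite_subset by blast
  assume "\<not> ?ys ! i \<le> ?xs ! i"
  then have lt: "?xs ! i < ?ys ! i" by simp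
  have "(!) ?xs ` {..i} \<subseteq> (!) ?ys ` {..<i}"
  proof
    fix x assume "x \<in> (!) ?xs ` {..i}"
    then obtain j where j: "j \<le> i" "x = ?xs ! j" by auto
    have "x \<le> ?xs ! i"
      using j assms fs by (auto intro!: sorted_nth_mono)
    moreover have "x \<in> set ?xs"
      unfolding j(2) using j(1) assms(3) by (intro nth_mem) simp
    then have "x \<in> set ?ys" using assms fs by auto
    then obtain k where k: "k < length ?ys" "x = ?ys ! k" by (auto simp: in_set_conv_nth)
    ultimately have "?ys ! k < ?ys ! i" using lt by simp
    moreover have "?ys ! i \<le> ?ys ! k" if "i \<le> k"
      using that k by (intro sorted_nth_mono) auto
    ultimately have "k < i" by (meson not_less)
    then show "x \<in> (!) ?ys ` {..<i}" using k by auto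
  qed
  then have "card ((!) ?xs ` {..i}) \<le> card {..<i}"
    by (meson card_mono card_image_le finite_imageI finite_lessThan le_trans)
  moreover have "inj_on ((!) ?xs) {..i}"
    using assms fs by (intro inj_on_nth) auto
  ultimately show False by (simp add: card_image)
qed

section \<open>Nested and regular systems\<close>

locale nested_regular_system =
  fixes \<Gamma> :: cord and F :: "cord \<Rightarrow> nat \<Rightarrow> cord"
  assumes fs: "fs_system \<Gamma> F" and nested: "nested_system \<Gamma> F" and regular: "regular_system \<Gamma> F"
begin

lemma F_zero [simp]: "F 0 n = 0"
  using fs by (auto simp: fs_system_def fundamental_sequence_def)

lemma foldl_F_zero [simp]: "foldl F 0 xs = 0"
  by (induction xs) simp_all

lemma F_mono: "a \<le> \<Gamma> \<Longrightarrow> m \<le> n \<Longrightarrow> F a m \<le> F a n"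
  using fs by (cases "a = 0") (auto simp: fs_system_def fundamental_sequence_def mono_def)

lemma le_iff_F_less:
  assumes "a \<le> \<Gamma>" "0 < a"
  shows "a \<le> c \<longleftrightarrow> (\<forall>n. F a n < c)"
proof -
  have "a = (SUP n. osuc (F a n))"
    using assms fs by (auto simp: fs_system_def fundamental_sequence_def)
  moreover have "(SUP n. osuc (F a n)) \<le> c \<longleftrightarrow> (\<forall>n. F a n < c)"
    by (subst Sup_cord_le_iff) (auto simp: osuc_le_iff)
  ultimately show ?thesis by metis
qed

lemma F_less: "a \<le> \<Gamma> \<Longrightarrow> 0 < a \<Longrightarrow> F a n < a"
  using le_iff_F_less by blast

lemma F_le: "a \<le> \<Gamma> \<Longrightarrow> F a n \<le> a"
  by (cases "a = 0") (auto simp: F_less zero_less_cord_iff less_imp_le)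

lemma F_le_Gamma: "a \<le> \<Gamma> \<Longrightarrow> F a n \<le> \<Gamma>"
  using F_le order_trans by blast

lemma fs_apply_le:
  assumes "finite s" "a \<le> \<Gamma>"
  shows "fs_apply F a s \<le> a"
  using assms(1)
proof (induction s rule: finite_linorder_max_induct)
  case (insert n s)
  then have "fs_apply F a s \<le> \<Gamma>" using assms(2) by simp
  then show ?case using insert F_le order_trans by (metis fs_apply_insert)
qed simp

section \<open>Descent along a fixed index\<close>

abbreviation reach :: "nat \<Rightarrow> cord \<Rightarrow> cord \<Rightarrow> bool" where
  "reach n \<equiv> (\<lambda>x y. y = F x n)\<^sup>*\<^sup>*"

lemma reach_le: "reach n a b \<Longrightarrow> a \<le> \<Gamma> \<Longrightarrow> b \<le> a"
  by (induction rule: rtranclp_induct) (auto intro: order_trans F_le)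

lemma reach_F_of_F:
  assumes "a \<le> \<Gamma>" "1 < n" "n \<le> m"
  shows "reach n (F a m) (F a n)"
proof (cases "a = 0")
  case False
  \<comment> \<open>Stated for every \<open>c\<close> between \<open>F a n\<close> and
    \<open>a\<close>, so that the descent from \<open>F a m\<close> can be followed step by
    step.\<close>
  have "reach n c (F a n)" if "F a n \<le> c" "c < a" for c
    using that
  proof (induction c rule: less_induct)
    case (less c)
    show ?case
    proof (cases "F a n = c")
      case False
      then have lt: "F a n < c" using less.prems by simp
      \<comment> \<open>Otherwise \<open>c > F a n > F c n\<close> with \<open>c < a\<close>, which
        nestedness excludes.\<close>
      then have "F a n \<le> F c n"
        using nested assms less.prems unfolding nested_system_def by (meson not_less)
      moreover have "F c n < c"
        using lt less.prems assms by (metis F_less le_less_trans less_imp_le order_trans zero_le_cord)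
      ultimately have "reach n (F c n) (F a n)" using less by (meson less_trans)
      then show ?thesis by (simp add: converse_rtranclp_into_rtranclp)
    qed simp
  qed
  then show ?thesis using assms False F_mono F_less zero_less_cord_iff by blast
qed simp

text \<open>After the step to \<open>F a n\<close>, nestedness descends to \<open>F a m\<close> with
  index \<open>m\<close>. All of this happens below \<open>a\<close>, so induction replaces each
  step by steps with index \<open>n\<close>.\<close>

lemma reach_F_mono:
  assumes "a \<le> \<Gamma>" "1 < m" "m \<le> n"
  shows "reach n a (F a m)"
  using assms(1)
proof (induction a rule: less_induct)
  case (less a)
  show ?case
  proof (cases "a = 0")
    case False
    have "reach m (F a n) (F a m)" using reach_F_of_F assms less.prems by blast
    then have "reach n (F a n) (F a m)"
    proof (induction rule: rtranclp_induct)
      case (step y z)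
      have "y \<le> F a n" using step(1) reach_le F_le_Gamma less.prems by blast
      then have "y < a" using F_less False less.prems zero_less_cord_iff le_less_trans by blast
      then have "reach n y z" using less step(2) by simp
      then show ?case using step.IH by simp
    qed simp
    then show ?thesis by (simp add: converse_rtranclp_into_rtranclp)
  qed simp
qed

lemma reach_mono:
  assumes "reach m a b" "a \<le> \<Gamma>" "1 < m" "m \<le> n"
  shows "reach n a b"
  using assms(1)
proof (induction rule: rtranclp_induct)
  case (step y z)
  have "y \<le> \<Gamma>" using step(1) reach_le assms by (meson order_trans)
  then have "reach n y z" using reach_F_mono assms step(2) by blast
  then show ?case using step.IH by simp
qed simp

text \<open>A nonempty descent from \<open>a\<close> to \<open>b\<close> passes through
  \<open>F a p\<close> first; from \<open>b\<close> it continues to \<open>F b p\<close> and, by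
  nestedness, to \<open>F b q\<close>.\<close>

lemma reach_F_F:
  assumes "reach p a b" "a \<le> \<Gamma>" "1 < q" "q \<le> p"
  shows "reach p (F a p) (F b q)"
proof -
  have bG: "b \<le> \<Gamma>" using assms reach_le order_trans by blast
  then have b: "reach p (F b p) (F b q)"
    using reach_F_of_F reach_mono F_le_Gamma assms by blast
  have "a = b \<or> reach p (F a p) b"
    using assms(1) by (rule converse_rtranclpE) blast+
  then show ?thesis
  proof
    assume "a = b"
    then show ?thesis using b by metis
  next
    assume "reach p (F a p) b"
    moreover have "reach p b (F b p)" by (rule r_into_rtranclp) (rule refl)
    ultimately have "reach p (F a p) (F b p)" by (rule rtranclp_trans)
    then show ?thesis using b by (rule rtranclp_trans)
  qed
qed

text \<open>The inequality \<open>b \<le> a\<close> is in general not preserved by fundamental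
  sequences, so the induction carries \<open>reach n a b\<close> instead. As \<open>xs\<close> is
  sorted, \<open>n\<close> can be raised to the next entry.\<close>

lemma foldl_F_le:
  assumes "list_all2 (\<le>) ys xs" "sorted xs" "\<forall>y\<in>set ys. 1 < y"
    and "reach n a b" "a \<le> \<Gamma>" "1 < n" "\<forall>x\<in>set xs. n \<le> x"
  shows "foldl F b ys \<le> foldl F a xs"
  using assms
proof (induction arbitrary: a b n rule: list_all2_induct)
  case Nil
  then show ?case using reach_le by simp
next
  case (Cons y ys x xs)
  have "reach x a b" 
    using Cons.prems reach_mono[of n a b x] by simp
  then have "reach x (F a x) (F b y)" 
    using Cons.prems Cons.hyps by (intro reach_F_F) simp_all
  then show ?case
    using Cons.prems Cons.hyps
    by (simp, intro Cons.IH[where n = x]) (auto simp: F_le_Gamma)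
qed

section \<open>Regularity and sums\<close>

lemma F_plus:
  assumes b: "is_CNF b bs" "bs \<noteq> []" and d: "0 < d" "d \<le> omega_pow (last bs)" and G: "b + d \<le> \<Gamma>"
  shows "F (b + d) n = b + F d n"
proof -
  obtain cs where cs: "is_CNF d cs" using CNF_exists by blast
  then have "cs \<noteq> []" using d(1) omega_sum_pos_iff by (auto simp: is_CNF_def)
  then obtain es e where es: "cs = es @ [e]" by (metis rev_exhaust)
  have d_eq: "d = omega_sum es + omega_pow e"
    using cs es by (simp add: is_CNF_def omega_sum_append)
  have b_eq: "b = omega_sum bs" using b by (simp add: is_CNF_def)
  have le: "c \<le> last bs" if "c \<in> set cs" for c
    using that cs d(2) omega_pow_le_omega_sum omega_pow_le_mono_iff
    by (metis is_CNF_def order_trans)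
  have lb: "last bs \<le> x" if "x \<in> set bs" for x
  proof -
    have "sorted_wrt (\<ge>) (butlast bs @ [last bs])" using b by (simp add: is_CNF_def)
    then have "\<forall>x\<in>set (butlast bs). last bs \<le> x" by (simp add: sorted_wrt_append)
    moreover have "x \<in> set (butlast bs @ [last bs])" using that b(2) by simp
    ultimately show ?thesis by auto
  qed
  have es_sorted: "sorted_wrt (\<ge>) es" "\<forall>x\<in>set es. e \<le> x"
    using cs es by (auto simp: is_CNF_def sorted_wrt_append)
  \<comment> \<open>No exponent of \<open>d\<close> exceeds the last one of \<open>b\<close>, so the
    normal forms can be concatenated.\<close>
  have "sorted_wrt (\<ge>) (bs @ es)"
    using b es_sorted le lb es by (auto simp: sorted_wrt_append is_CNF_def intro: order_trans)
  then have "is_CNF (b + omega_sum es) (bs @ es)"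
    by (simp add: is_CNF_def b_eq omega_sum_append)
  moreover have "e \<le> last (bs @ es)" using le es es_sorted by (cases "es = []") auto
  moreover have "0 < b + omega_sum es"
    using b b_eq by (simp add: omega_sum_pos_iff plus_cord_pos_left)
  moreover have "(b + omega_sum es) + omega_pow e = b + d" by (simp add: d_eq plus_cord_assoc)
  \<comment> \<open>Regularity is applied to the whole sum here, and below to \<open>d\<close> alone
    in order to reassemble \<open>F d n\<close>.\<close>
  ultimately have "F (b + d) n = (b + omega_sum es) + F (omega_pow e) n"
    using regular G unfolding regular_system_def by metis
  also have "\<dots> = b + (omega_sum es + F (omega_pow e) n)" by (rule plus_cord_assoc)
  also have "omega_sum es + F (omega_pow e) n = F d n"
  proof (cases "es = []")
    case True
    then show ?thesis by (simp add: d_eq)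
  next
    case False
    then have "e \<le> last es" using es_sorted by simp
    moreover have "is_CNF (omega_sum es) es" using es_sorted by (simp add: is_CNF_def)
    moreover have "0 < omega_sum es" using False omega_sum_pos_iff by simp
    moreover have "d \<le> \<Gamma>" using G le_plus_cord_right order_trans by blast
    ultimately show ?thesis using regular d_eq unfolding regular_system_def by metis
  qed
  finally show ?thesis .
qed

text \<open>All values reached from \<open>d\<close> stay at most \<open>d\<close>, so
  \<open>F_plus\<close> applies at each step until \<open>d\<close> is used up.\<close>

lemma fs_apply_plus:
  assumes b: "is_CNF b bs" "bs \<noteq> []" and d: "d \<le> omega_pow (last bs)" and G: "b + d \<le> \<Gamma>"
    and s: "finite s"
  shows "0 < fs_apply F d s \<Longrightarrow> fs_apply F (b + d) s = b + fs_apply F d s"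
  using s
proof (induction s rule: finite_linorder_max_induct)
  case (insert n s)
  let ?e = "fs_apply F d s"
  have e: "0 < ?e" using insert by (auto simp: fs_apply_insert zero_less_cord_iff)
  have "d \<le> \<Gamma>" using G le_plus_cord_right order_trans by blast
  then have "?e \<le> d" using insert fs_apply_le by blast
  then have "F (b + ?e) n = b + F ?e n"
    using b d e G plus_cord_mono[of ?e d b] by (intro F_plus) auto
  then show ?case using insert e by (simp add: fs_apply_insert)
qed simp

text \<open>Before the maximum of \<open>s\<close> the part above \<open>b\<close> is still
  positive, so \<open>F_plus\<close> covers the last step too, which takes that part to 0.\<close>

lemma fs_apply_plus_alpha_size:
  assumes b: "is_CNF b bs" "bs \<noteq> []" and d: "d \<le> omega_pow (last bs)" "0 < d" and G: "b + d \<le> \<Gamma>"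
    and s: "alpha_size F d s"
  shows "fs_apply F (b + d) s = b"
proof -
  have "finite s" "s \<noteq> {}" using s d by (auto simp: alpha_size_def)
  then obtain n A where A: "s = insert n A" "finite A" "\<And>x. x \<in> A \<Longrightarrow> x < n"
    by (rule finite_eq_insert_Max) blast
  let ?e = "fs_apply F d A"
  have e: "0 < ?e" "F ?e n = 0" using s A by (simp_all add: alpha_size_insert)
  have "d \<le> \<Gamma>" using G le_plus_cord_right order_trans by blast
  then have "?e \<le> d" using A fs_apply_le by blast
  then have "F (b + ?e) n = b + F ?e n"
    using b d e G plus_cord_mono[of ?e d b] by (intro F_plus) auto
  then show ?thesis using A e fs_apply_plus[OF b d(1) G A(2) e(1)] by (simp add: fs_apply_insert)
qed

end

section \<open>The barriers of \<open>\<alpha>\<close>-size sets\<close>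

locale size_system = nested_regular_system +
  fixes M :: "nat set"
  assumes infM: "infinite M" and M_gt: "\<And>m. m \<in> M \<Longrightarrow> 1 < m"
begin

abbreviation B :: "cord \<Rightarrow> nat set set" where "B \<equiv> size_family F M"

section \<open>Fronts and smoothness\<close>

lemma B_D: "s \<in> B a \<Longrightarrow> finite s \<and> s \<subseteq> M \<and> fs_apply F a s = 0"
  by (simp add: size_family_def alpha_size_def)

lemma B_zero: "B 0 = {{}}"
proof -
  have "fs_apply F 0 s = 0" for s by (simp add: fs_apply_def)
  then show ?thesis by (auto simp: size_family_def alpha_size_def)
qed

lemma empty_notin_B: "0 < a \<Longrightarrow> {} \<notin> B a"
  by (auto simp: size_family_def alpha_size_def)

lemma insert_in_B_iff:
  assumes "finite s" "\<And>x. x \<in> s \<Longrightarrow> x < n"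
  shows "insert n s \<in> B a \<longleftrightarrow> insert n s \<subseteq> M \<and> F (fs_apply F a s) n = 0 \<and> 0 < fs_apply F a s"
  using alpha_size_insert[OF assms] by (simp add: size_family_def)

text \<open>The shortest initial segment with value 0 has the right size; it is found by dropping
  maxima while the value stays 0.\<close>

lemma init_seg_in_B:
  assumes "finite s" "s \<subseteq> M" "fs_apply F a s = 0"
  shows "\<exists>u\<in>B a. u = s \<or> proper_init_seg u s"
  using assms
proof (induction s rule: finite_linorder_max_induct)
  case empty
  then show ?case using B_zero by simp
next
  case (insert n s)
  show ?case
  proof (cases "fs_apply F a s = 0")
    case True
    then obtain u where u: "u \<in> B a" "u = s \<or> proper_init_seg u s" using insert by auto
    then have "proper_init_seg u (insert n s)" using insert(2) by (intro proper_init_seg_insert) auto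
    then show ?thesis using u by blast
  next
    case False
    then have "insert n s \<in> B a"
      using insert by (subst insert_in_B_iff) (auto simp: fs_apply_insert zero_less_cord_iff)
    then show ?thesis by blast
  qed
qed

lemma init_seg_of_infinite:
  assumes a: "a \<le> \<Gamma>" and X: "infinite X" "X \<subseteq> M"
  shows "\<exists>s\<in>B a. proper_init_seg s X"
proof -
  have "\<exists>s. finite s \<and> proper_init_seg s X \<and> fs_apply F a s = 0"
    if "finite r" "proper_init_seg r X" for r
    using that
  \<comment> \<open>Appending the next element of \<open>X\<close> lowers the ordinal
    \<open>fs_apply F a r\<close>, so the process reaches 0.\<close>
  proof (induction "fs_apply F a r" arbitrary: r rule: less_induct)
    case less
    show ?case
    proof (cases "fs_apply F a r = 0")
      case False
      define n where "n = (LEAST n. n \<in> X - r)"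
      have "X - r \<noteq> {}" using X less.prems by (metis Diff_infinite_finite finite.emptyI)
      then have n: "n \<in> X - r" unfolding n_def by (metis LeastI ex_in_conv)
      have n_le: "n \<le> m" if "m \<in> X - r" for m
        using that unfolding n_def by (rule Least_le)
      have lt: "x < n" if "x \<in> r" for x
        using n that less.prems by (metis DiffE proper_init_seg_def linorder_neqE_nat)
      have sub: "insert n r \<subseteq> X" using n less.prems by (auto simp: proper_init_seg_def)
      have "proper_init_seg (insert n r) X"
        unfolding proper_init_seg_def
      proof (intro conjI ballI impI)
        show "insert n r \<subset> X" using sub X less.prems by (metis finite_insert psubsetI)
        fix y x assume "y \<in> insert n r" "x \<in> X" "x < y"
        then show "x \<in> insert n r" using n_le lt by (metis DiffI insertE insertI2 less_trans not_less)
      qed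
      moreover have "fs_apply F a (insert n r) < fs_apply F a r"
      proof -
        have "fs_apply F a r \<le> \<Gamma>" using a less.prems fs_apply_le order_trans by blast
        then show ?thesis
          using False lt less.prems F_less by (simp add: fs_apply_insert zero_less_cord_iff)
      qed
      ultimately show ?thesis using less by blast
    qed (use less in blast)
  qed
  from this[of "{}"] obtain s where s: "finite s" "proper_init_seg s X" "fs_apply F a s = 0"
    using X by (auto simp: proper_init_seg_def)
  moreover have "s \<subseteq> M" using s X by (auto simp: proper_init_seg_def)
  ultimately obtain u where u: "u \<in> B a" "u = s \<or> proper_init_seg u s"
    using init_seg_in_B by blast
  have "proper_init_seg u X"
    using u(2)
  proof
    assume "proper_init_seg u s"
    then show ?thesis using s(2) unfolding proper_init_seg_def by blast
  qed (use s in simp)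
  then show ?thesis using u by blast
qed

lemma base_B:
  assumes "a \<le> \<Gamma>" "0 < a"
  shows "base (B a) = M"
proof
  show "base (B a) \<subseteq> M" using B_D by blast
  show "M \<subseteq> base (B a)"
  proof
    fix m assume m: "m \<in> M"
    \<comment> \<open>A nonempty initial segment of this set must contain its least element
      \<open>m\<close>.\<close>
    let ?X = "M \<inter> {m..}"
    have "?X = M - {..<m}" by auto
    then have "infinite ?X" using infM by (simp add: Diff_infinite_finite)
    then obtain s where s: "s \<in> B a" "proper_init_seg s ?X"
      using init_seg_of_infinite assms by blast
    then obtain x where x: "x \<in> s" using empty_notin_B assms by (metis ex_in_conv)
    then have "x = m \<or> m < x" using s by (auto simp: proper_init_seg_def)
    then have "m \<in> s" using s x m by (auto simp: proper_init_seg_def)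
    then show "m \<in> base (B a)" using s by blast
  qed
qed

text \<open>If \<open>t\<close> were pointwise below \<open>s\<close> on the first
  \<open>card s\<close> places, \<open>foldl_F_le\<close> would bring \<open>a\<close> to 0 along
  \<open>t\<close> before its maximum is used.\<close>

lemma smooth_B:
  assumes a: "a \<le> \<Gamma>"
  shows "smooth (B a)"
  unfolding smooth_def
proof (intro ballI impI, rule ccontr)
  fix s t assume s: "s \<in> B a" and t: "t \<in> B a" and c: "card s < card t"
  let ?xs = "sorted_list_of_set s" and ?ys = "sorted_list_of_set t"
  assume "\<not> (\<exists>i<card s. ?xs ! i < ?ys ! i)"
  then have le: "?ys ! i \<le> ?xs ! i" if "i < card s" for i using that by (meson not_less)
  have fin: "finite s" "finite t" and sub: "s \<subseteq> M" "t \<subseteq> M" using s t B_D by auto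
  let ?zs = "take (card s) ?ys"
  have "list_all2 (\<le>) ?zs ?xs"
    using le c by (auto simp: list_all2_conv_all_nth)
  moreover have "\<forall>y\<in>set ?zs. 1 < y" using fin sub M_gt by (auto dest!: in_set_takeD)
  moreover have "\<forall>x\<in>set ?xs. 2 \<le> x" using fin sub M_gt by fastforce
  \<comment> \<open>The comparison starts with the trivial descent from \<open>a\<close> to itself;
    index 2 is admissible since all elements of \<open>M\<close> exceed 1.\<close>
  ultimately have "foldl F a ?zs \<le> foldl F a ?xs"
    using a by (intro foldl_F_le[where n = 2]) auto
  then have z: "foldl F a ?zs = 0"
    using B_D[OF s] by (simp add: fs_apply_def order_antisym)
  have "t \<noteq> {}" using c by auto
  then obtain n A where A: "t = insert n A" "finite A" "\<And>x. x \<in> A \<Longrightarrow> x < n"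
    by (rule finite_eq_insert_Max[OF fin(2)]) blast
  have ys: "?ys = sorted_list_of_set A @ [n]"
    using sorted_list_of_set_union[of A "{n}"] A by simp
  have "n \<notin> A" using A by blast
  \<comment> \<open>Thus \<open>A\<close> still contains all of \<open>?zs\<close>, and a value 0
    stays 0.\<close>
  then have "card s \<le> card A" using c A by simp
  then have "sorted_list_of_set A = ?zs @ drop (card s) (sorted_list_of_set A)"
    using ys by simp
  then have "fs_apply F a A = 0"
    unfolding fs_apply_def by (metis foldl_append z foldl_F_zero)
  then show False using t A by (simp add: insert_in_B_iff)
qed

text \<open>Passing to a superset cannot raise the element at a given place, whereas smoothness
  demands a place where it rises.\<close>

lemma no_proper_subset_B:
  assumes "a \<le> \<Gamma>" "s \<in> B a" "t \<in> B a"
  shows "\<not> s \<subset> t"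
proof
  assume st: "s \<subset> t"
  have fin: "finite t" using assms B_D by blast
  then have "card s < card t" using st psubset_card_mono by blast
  then obtain i where "i < card s" "sorted_list_of_set s ! i < sorted_list_of_set t ! i"
    using smooth_B assms unfolding smooth_def by blast
  then show False using nth_sorted_list_of_subset_ge[of t s i] fin st by auto
qed

text \<open>Proper initial segments are proper subsets, so \<open>no_proper_subset_B\<close> also
  settles the last condition of a front.\<close>

lemma barrier_B:
  assumes "a \<le> \<Gamma>" "0 < a"
  shows "barrier (B a)"
  unfolding barrier_def front_def base_B[OF assms]
  using no_proper_subset_B init_seg_of_infinite assms infM B_D
  by (auto simp: proper_init_seg_def)

section \<open>Heights in the tree\<close>

lemma front_tree_zero_iff:
  assumes "s \<in> front_tree (B a)" "a \<le> \<Gamma>" "0 < a"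
  shows "s \<in> B a \<longleftrightarrow> fs_apply F a s = 0"
proof -
  have "finite s" "s \<subseteq> M" using assms base_B by (auto simp: front_tree_def)
  \<comment> \<open>At a node of the tree, an initial segment in \<open>B a\<close> cannot be
    proper, so value 0 makes the node a leaf.\<close>
  then show ?thesis using init_seg_in_B[of s a] B_D assms(1) by (auto simp: front_tree_def)
qed

lemma tree_child_less:
  assumes "(t, s) \<in> tree_child (B a)" "a \<le> \<Gamma>" "0 < a"
  obtains n where "n \<in> M" "\<And>x. x \<in> s \<Longrightarrow> x < n" "t = insert n s"
    "fs_apply F a t = F (fs_apply F a s) n" "0 < fs_apply F a s"
proof -
  obtain n where n: "\<And>x. x \<in> s \<Longrightarrow> x < n" "t = insert n s"
    using assms(1) by (auto simp: tree_child_def)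
  have st: "s \<in> front_tree (B a)" "t \<in> front_tree (B a)"
    using assms(1) by (auto simp: tree_child_def)
  then have fin: "finite s" and "n \<in> M" using assms n base_B by (auto simp: front_tree_def)
  moreover have "proper_init_seg s t" using n proper_init_seg_insert by metis
  then have "s \<notin> B a" using st by (auto simp: front_tree_def)
  then have "0 < fs_apply F a s" using front_tree_zero_iff st assms by (simp add: zero_less_cord_iff)
  ultimately show ?thesis using that n fs_apply_insert by metis
qed

lemma tree_child_insert:
  assumes "s \<in> front_tree (B a)" "a \<le> \<Gamma>" "0 < a" "0 < fs_apply F a s"
    and n: "n \<in> M" "\<And>x. x \<in> s \<Longrightarrow> x < n"
  shows "(insert n s, s) \<in> tree_child (B a)"
proof -
  have "s \<notin> B a" using front_tree_zero_iff assms by auto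
  have "\<not> proper_init_seg u (insert n s)" if u: "u \<in> B a" for u
  proof
    assume p: "proper_init_seg u (insert n s)"
    have "n \<notin> u"
    proof
      assume "n \<in> u"
      then have "insert n s \<subseteq> u" using p n by (auto simp: proper_init_seg_def)
      then show False using p by (auto simp: proper_init_seg_def)
    qed
    then have "u = s \<or> proper_init_seg u s" using p by (auto simp: proper_init_seg_def)
    then show False using u \<open>s \<notin> B a\<close> assms(1) by (auto simp: front_tree_def)
  qed
  then show ?thesis using assms base_B by (auto simp: tree_child_def front_tree_def)
qed

lemma wf_tree_child:
  assumes "a \<le> \<Gamma>" "0 < a"
  shows "wf (tree_child (B a))"
proof (rule wf_subset)
  show "wf (inv_image {(x, y::cord). x < y} (fs_apply F a))" by (simp add: wf_inv_image wf)
  show "tree_child (B a) \<subseteq> inv_image {(x, y::cord). x < y} (fs_apply F a)"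
  proof (intro subrelI)
    fix t s assume ts: "(t, s) \<in> tree_child (B a)"
    then have "finite s" by (auto simp: tree_child_def front_tree_def)
    then have "fs_apply F a s \<le> \<Gamma>" using assms fs_apply_le order_trans by blast
    then show "(t, s) \<in> inv_image {(x, y::cord). x < y} (fs_apply F a)"
      using tree_child_less[OF ts assms] F_less by (metis in_inv_image case_prodI mem_Collect_eq)
  qed
qed

lemma node_height_B:
  assumes a: "a \<le> \<Gamma>" "0 < a" and s: "s \<in> front_tree (B a)"
  shows "node_height (B a) s = fs_apply F a s"
  using wf_tree_child[OF a] s
proof (induction s rule: wf_induct_rule)
  case (less s)
  let ?h = "node_height (B a)" and ?T = "{t. (t, s) \<in> tree_child (B a)}"
  \<comment> \<open>Only children of \<open>s\<close> are evaluated, so the restriction made by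
    \<open>wfrec\<close> has no effect.\<close>
  have h: "?h s = (if s \<in> B a then 0 else SUP t\<in>?T. osuc (?h t))"
    unfolding node_height_def
    by (subst wfrec[OF wf_tree_child[OF a]])
      (auto simp: cut_def intro!: arg_cong[where f = Sup] image_cong)
  have fin: "finite s" using less.prems by (auto simp: front_tree_def)
  let ?b = "fs_apply F a s"
  show ?case
  proof (cases "s \<in> B a")
    case True
    then show ?thesis using h B_D by simp
  next
    case False
    then have b: "0 < ?b" using front_tree_zero_iff less.prems a by (simp add: zero_less_cord_iff)
    have bG: "?b \<le> \<Gamma>" using a fin fs_apply_le order_trans by blast
    let ?N = "{n \<in> M. \<forall>x\<in>s. x < n}"
    have T: "?T = (\<lambda>n. insert n s) ` ?N"
    proof (intro equalityI subsetI)
      fix t assume "t \<in> ?T"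
      then have "(t, s) \<in> tree_child (B a)" by simp
      then obtain n where "n \<in> M" "\<And>x. x \<in> s \<Longrightarrow> x < n" "t = insert n s"
        using tree_child_less a by metis
      then show "t \<in> (\<lambda>n. insert n s) ` ?N" by simp
    next
      fix t assume "t \<in> (\<lambda>n. insert n s) ` ?N"
      then obtain n where "n \<in> M" "\<And>x. x \<in> s \<Longrightarrow> x < n" "t = insert n s" by blast
      then show "t \<in> ?T" using tree_child_insert[OF less.prems a b] by simp
    qed
    have hN: "?h (insert n s) = F ?b n" if "n \<in> ?N" for n
    proof -
      have c: "(insert n s, s) \<in> tree_child (B a)" using that T by blast
      then have "insert n s \<in> front_tree (B a)" by (simp add: tree_child_def)
      then show ?thesis using less.IH[OF c] that fin by (simp add: fs_apply_insert)
    qed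
    have cof: "\<exists>m\<in>?N. n \<le> m" for n
    proof -
      have "\<exists>m. m \<in> M \<and> Max (insert n s) < m" using infM infinite_nat_iff_unbounded by blast
      then show ?thesis using fin by (auto intro!: bexI)
    qed
    show ?thesis
    proof (rule cord_eq_leI)
      fix c
      have "?h s \<le> c \<longleftrightarrow> (\<forall>n\<in>?N. F ?b n < c)"
        using False hN unfolding h T
        by (simp add: image_image Sup_cord_le_iff osuc_le_iff)
      \<comment> \<open>The admissible indices \<open>?N\<close> are cofinal and \<open>F ?b\<close>
        is nondecreasing, so both ranges have the same bounds.\<close>
      also have "\<dots> \<longleftrightarrow> (\<forall>n. F ?b n < c)"
        using cof F_mono[OF bG] le_less_trans by blast
      also have "\<dots> \<longleftrightarrow> ?b \<le> c" using le_iff_F_less bG b by simp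
      finally show "?h s \<le> c \<longleftrightarrow> ?b \<le> c" .
    qed
  qed
qed

lemma height_B:
  assumes "a \<le> \<Gamma>" "0 < a"
  shows "height (B a) = a"
proof -
  have "{} \<in> front_tree (B a)" by (simp add: front_tree_def proper_init_seg_def)
  then show ?thesis using node_height_B assms by (simp add: height_def)
qed

section \<open>Decomposition along the Cantor normal form\<close>

lemma B_plus:
  assumes b: "is_CNF b bs" "bs \<noteq> []" and d: "d \<le> omega_pow (last bs)" "0 < d" and G: "b + d \<le> \<Gamma>"
  shows "B (b + d) = front_oplus (B b) (B d)"
proof -
  have bpos: "0 < b" using b by (simp add: is_CNF_def omega_sum_pos_iff)
  \<comment> \<open>A set \<open>s\<close> of size \<open>d\<close> uses up exactly the right
    summand, so what follows it is measured from \<open>b\<close>.\<close>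
  have union: "s \<union> t \<in> B (b + d) \<longleftrightarrow> t \<in> B b"
    if s: "s \<in> B d" and st: "\<forall>x\<in>s. \<forall>y\<in>t. x < y" and t: "finite t" "t \<subseteq> M" for s t
  proof -
    have bds: "fs_apply F (b + d) s = b" and fs: "finite s" "s \<subseteq> M"
      using s fs_apply_plus_alpha_size[OF assms] by (auto simp: size_family_def alpha_size_def)
    show ?thesis
    proof (cases "t = {}")
      case True
      \<comment> \<open>Both sides fail: since \<open>b > 0\<close>, the value at \<open>s\<close>
        is not 0 and \<open>{}\<close> is not of size \<open>b\<close>.\<close>
      then show ?thesis using bds bpos B_D empty_notin_B by (metis less_irrefl sup_bot_right)
    next
      case False
      then obtain n A where A: "t = insert n A" "finite A" "\<And>x. x \<in> A \<Longrightarrow> x < n"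
        by (rule finite_eq_insert_Max[OF t(1)]) blast
      have "fs_apply F (b + d) (s \<union> A) = fs_apply F b A"
        using fs_apply_union[of s A F "b + d"] A fs st bds by simp
      moreover have "insert n (s \<union> A) \<in> B (b + d) \<longleftrightarrow>
          F (fs_apply F (b + d) (s \<union> A)) n = 0 \<and> 0 < fs_apply F (b + d) (s \<union> A)"
        using A fs st t by (subst insert_in_B_iff) auto
      moreover have "insert n A \<in> B b \<longleftrightarrow> F (fs_apply F b A) n = 0 \<and> 0 < fs_apply F b A"
        using A t by (subst insert_in_B_iff) auto
      ultimately show ?thesis using A by simp
    qed
  qed
  show ?thesis
  proof (intro equalityI subsetI)
    fix u assume u: "u \<in> B (b + d)"
    then have fin: "finite u" "u \<subseteq> M" and u0: "fs_apply F (b + d) u = 0" using B_D by auto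
    \<comment> \<open>Otherwise \<open>b + d\<close> would end in \<open>b + fs_apply F d u\<close>,
      which is positive. Hence an initial segment of \<open>u\<close> has size
      \<open>d\<close>.\<close>
    have "fs_apply F d u = 0"
      using fs_apply_plus[OF b d(1) G fin(1)] u0 bpos plus_cord_pos_left
      by (metis less_irrefl zero_less_cord_iff)
    then obtain s where s: "s \<in> B d" "s = u \<or> proper_init_seg s u"
      using init_seg_in_B fin by blast
    then have u_eq: "u = s \<union> (u - s)" by (auto simp: proper_init_seg_def)
    have lt: "\<forall>x\<in>s. \<forall>y\<in>u - s. x < y"
    proof (intro ballI, rule ccontr)
      fix x y assume xy: "x \<in> s" "y \<in> u - s" "\<not> x < y"
      then have "y < x" by (metis DiffD2 linorder_neqE_nat)
      then show False using s(2) xy unfolding proper_init_seg_def by blast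
    qed
    then have "u - s \<in> B b" using union[OF s(1) lt] u u_eq fin by auto
    then show "u \<in> front_oplus (B b) (B d)"
      using s lt u_eq unfolding front_oplus_def by blast
  next
    fix u assume "u \<in> front_oplus (B b) (B d)"
    then show "u \<in> B (b + d)" using union B_D by (auto simp: front_oplus_def)
  qed
qed

text \<open>Removing the last exponent matches the left bracketing of \<open>is_oplus\<close> and
  leaves a prefix to which \<open>B_plus\<close> applies.\<close>

lemma is_oplus_B:
  assumes "sorted_wrt (\<ge>) bs" "bs \<noteq> []" "omega_sum bs \<le> \<Gamma>"
  shows "is_oplus (map (\<lambda>b. B (omega_pow b)) bs) (B (omega_sum bs))"
  using assms
proof (induction bs rule: rev_induct)
  case (snoc b bs)
  show ?case
  proof (cases "bs = []")
    case True
    then show ?thesis by (simp add: is_oplus.single)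
  next
    case False
    let ?a = "omega_sum bs" and ?d = "omega_pow b"
    have G: "?a + ?d \<le> \<Gamma>" using snoc.prems by (simp add: omega_sum_append)
    then have aG: "?a \<le> \<Gamma>" "?d \<le> \<Gamma>"
      using le_plus_cord_left le_plus_cord_right order_trans by blast+
    have sorted: "sorted_wrt (\<ge>) bs" "b \<le> last bs"
      using snoc.prems False by (auto simp: sorted_wrt_append)
    have "base (B ?a) = M" "base (B ?d) = M"
      using base_B aG False by (simp_all add: omega_sum_pos_iff omega_pow_pos)
    then have "oplus_defined (B ?a) (B ?d)" by (auto simp: oplus_defined_def)
    moreover have "B (?a + ?d) = front_oplus (B ?a) (B ?d)"
      using False sorted G
      by (intro B_plus) (auto simp: is_CNF_def omega_pow_le_mono_iff omega_pow_pos)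
    ultimately show ?thesis
      using is_oplus.snoc[OF snoc.IH] sorted False aG by (simp add: omega_sum_append)
  qed
qed simp

lemma SD_barrier_B:
  assumes a: "a \<le> \<Gamma>"
  shows "SD_barrier (B a)"
\<comment> \<open>The empty normal form of 0 has no counterpart in \<open>is_oplus\<close>, whose
  lists are nonempty; the family is then the degenerate front.\<close>
proof (cases "a = 0")
  case True
  then show ?thesis by (simp add: SD_barrier_def B_zero)
next
  case False
  then have pos: "0 < a" by (simp add: zero_less_cord_iff)
  obtain bs where bs: "is_CNF a bs" using CNF_exists by blast
  then have a_eq: "a = omega_sum bs" and ne: "bs \<noteq> []" and "sorted_wrt (\<ge>) bs"
    using False by (auto simp: is_CNF_def)
  then have "is_oplus (map (\<lambda>b. B (omega_pow b)) bs) (B a)" using is_oplus_B a by blast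
  \<comment> \<open>Each summand lies within \<Gamma>, so the results on barriers, smoothness and
    heights apply to it.\<close>
  moreover have "omega_pow (bs ! i) \<le> \<Gamma>" if "i < length bs" for i
    using that a a_eq omega_pow_le_omega_sum by (meson nth_mem order_trans)
  ultimately have "decomposable (B a)"
    unfolding decomposable_def height_B[OF a pos] using bs
    by (intro exI[of _ bs] exI[of _ "map (\<lambda>b. B (omega_pow b)) bs"])
      (simp add: barrier_B smooth_B height_B omega_pow_pos)
  then show ?thesis using barrier_B smooth_B a pos by (simp add: SD_barrier_def)
qed

end

theorem theorem3p6:
  fixes \<Gamma> :: cord and F :: "cord \<Rightarrow> nat \<Rightarrow> cord" and M :: "nat set"
  assumes "fs_system \<Gamma> F" and "nested_system \<Gamma> F" and "regular_system \<Gamma> F"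
    and "infinite M" and "Inf M > 1"
  shows "\<forall>\<alpha>\<le>\<Gamma>. SD_barrier (size_family F M \<alpha>)"
proof -
  have "1 < m" if "m \<in> M" for m
    using cInf_lower[OF that] assms(5) by simp
  then interpret size_system \<Gamma> F M
    using assms by unfold_locales
  show ?thesis using SD_barrier_B by blast
qed

end
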